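(* (Non-squeezing theorem.) Let $\mathbb{H}$ be a separable complex Hilbert space with a fixed orthonormal basis $\{e_n\}$ and the standard symplectic form $\omega$. Let $r,R>0$ and let $G$ be a domain in the cylinder $\Sigma_{R\mathbb{D}}=\{Z\in\mathbb{H}:|\langle Z,e_1\rangle|<R\}$. There exists $\varepsilon_0>0$ with the following property: if there exists a symplectomorphism $\Phi:r\mathbb{B}^\infty\to G$ such that $$\|Q\,\bar P^{-1}\|_{C^1(r\mathbb{B}^\infty)}\le\varepsilon_0,\qquad\text{where } P=\Phi_Z,\ Q=\Phi_{\bar Z},$$ then $r\le R$.
   Context: $\mathbb{B}^\infty=\{Z\in\mathbb{H}:\|Z\|<1\}$, $\mathbb{D}$ is the unit disc in $\mathbb{C}$. For $Z=\sum_j Z_je_j$ put $\bar Z=\sum_j\bar Z_je_j$. The standard symplectic form is $\omega=\frac i2\sum_j dZ_j\wedge d\bar Z_j$, i.e. $\omega(u,v)=-\mathrm{Im}\langle u,v\rangle$. A symplectomorphism between open subsets $\Omega_1,\Omega_2$ of $\mathbb{H}$ is a $C^1$-diffeomorphism $\Phi:\Omega_1\to\Omega_2$ with $\Phi^*\omega=\omega$. For a $C^1$ map $\Phi$, $P(Z)=\Phi_Z(Z)$ and $Q(Z)=\Phi_{\bar Z}(Z)$ are the bounded $\mathbb{C}$-linear operators determined by $d\Phi_Z(u)=P(Z)u+Q(Z)\bar u$ for $u\in\mathbb{H}$. For a $\mathbb{C}$-linear operator $P$, $\bar P u=\overline{P\bar u}$. When $\Phi$ is a symplectomorphism, $P(Z)$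 is invertible. The $C^1(r\mathbb{B}^\infty)$ norm refers to the operator-valued map $Z\mapsto Q(Z)\bar P(Z)^{-1}$ on $r\mathbb{B}^\infty$ (sup of operator norm of the map and of its first derivative; in particular the condition includes that this map is $C^1$). *)

theory Defs
  imports "HOL-Analysis.Analysis"
begin

text \<open>Complex inner product spaces. The inner product is linear in the first argument, and
  the norm and topology are those of the underlying real inner product \<open>Re \<langle>x, y\<rangle>\<close>.\<close>

class complex_inner = real_inner +
  fixes scaleC :: "complex \<Rightarrow> 'a \<Rightarrow> 'a"  (infixr "*\<^sub>C" 75)
    and cinner :: "'a \<Rightarrow> 'a \<Rightarrow> complex"
  assumes scaleC_add_right: "c *\<^sub>C (x + y) = c *\<^sub>C x + c *\<^sub>C y"
    and scaleC_add_left: "(c + d) *\<^sub>C x = c *\<^sub>C x + d *\<^sub>C x"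
    and scaleC_scaleC: "c *\<^sub>C d *\<^sub>C x = (c * d) *\<^sub>C x"
    and scaleC_of_real: "complex_of_real a *\<^sub>C x = a *\<^sub>R x"
    and cinner_commute: "cinner x y = cnj (cinner y x)"
    and cinner_add_left: "cinner (x + y) z = cinner x z + cinner y z"
    and cinner_scaleC_left: "cinner (c *\<^sub>C x) y = c * cinner x y"
    and Re_cinner: "Re (cinner x y) = inner x y"

class chilbert_space = complex_inner + complete_space

text \<open>A countably infinite orthonormal basis (so the space is separable), enumerated from \<open>0\<close>.\<close>

definition orthonormal_basis :: "(nat \<Rightarrow> 'a::chilbert_space) \<Rightarrow> bool" where
  "orthonormal_basis e \<longleftrightarrow>
     (\<forall>i j. cinner (e i) (e j) = (if i = j then 1 else 0)) \<and>
     (\<forall>Z. (\<lambda>j. cinner Z (e j) *\<^sub>C e j) sums Z)"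

definition conj_vec :: "(nat \<Rightarrow> 'a::chilbert_space) \<Rightarrow> 'a \<Rightarrow> 'a" where
  "conj_vec e Z = (\<Sum>j. cnj (cinner Z (e j)) *\<^sub>C e j)"

text \<open>Bounded operators are represented as elements of \<open>'a \<Rightarrow>\<^sub>L 'a\<close>, which are only real-linear;
  complex linearity is imposed separately. On complex-linear operators the norm of \<open>'a \<Rightarrow>\<^sub>L 'a\<close> is
  the usual operator norm.\<close>

definition complex_linear :: "('a::chilbert_space \<Rightarrow>\<^sub>L 'a) \<Rightarrow> bool" where
  "complex_linear T \<longleftrightarrow> (\<forall>c u. T (c *\<^sub>C u) = c *\<^sub>C T u)"

text \<open>For an orthonormal basis \<open>e\<close> the argument of \<^const>\<open>Blinfun\<close> below is bounded linear, because
  \<^term>\<open>conj_vec e\<close> is a real-linear isometry.\<close>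

definition conj_op :: "(nat \<Rightarrow> 'a::chilbert_space) \<Rightarrow> ('a \<Rightarrow>\<^sub>L 'a) \<Rightarrow> ('a \<Rightarrow>\<^sub>L 'a)" where
  "conj_op e T = Blinfun (\<lambda>u. conj_vec e (T (conj_vec e u)))"

definition inverse_op :: "('a::real_normed_vector \<Rightarrow>\<^sub>L 'a) \<Rightarrow> ('a \<Rightarrow>\<^sub>L 'a)" where
  "inverse_op T = (THE S. S o\<^sub>L T = id_blinfun \<and> T o\<^sub>L S = id_blinfun)"

definition C1_on :: "'a::real_normed_vector set \<Rightarrow> ('a \<Rightarrow> 'b::real_normed_vector) \<Rightarrow> bool" where
  "C1_on U f \<longleftrightarrow>
     (\<exists>f' :: 'a \<Rightarrow> 'a \<Rightarrow>\<^sub>L 'b. (\<forall>x\<in>U. (f has_derivative f' x) (at x)) \<and> continuous_on U f')"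

definition C1_norm :: "'a::real_normed_vector set \<Rightarrow> ('a \<Rightarrow> 'b::real_normed_vector) \<Rightarrow> ennreal" where
  "C1_norm U f =
     max (SUP x\<in>U. ennreal (norm (f x)))
         (SUP x\<in>U. ennreal (onorm (frechet_derivative f (at x))))"

definition symplectic_form :: "'a::chilbert_space \<Rightarrow> 'a \<Rightarrow> real" where
  "symplectic_form u v = - Im (cinner u v)"

definition symplectomorphism ::
    "'a::chilbert_space set \<Rightarrow> 'a set \<Rightarrow> ('a \<Rightarrow> 'a) \<Rightarrow> bool" where
  "symplectomorphism U V \<Phi> \<longleftrightarrow>
     open U \<and> open V \<and> bij_betw \<Phi> U V \<and> C1_on U \<Phi> \<and> C1_on V (inv_into U \<Phi>) \<and>
     (\<forall>Z\<in>U. \<forall>u v. symplectic_form (frechet_derivative \<Phi> (at Z) u) (frechet_derivative \<Phi> (at Z) v)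
                  = symplectic_form u v)"

text \<open>\<open>P = \<Phi>\<^sub>Z\<close> and \<open>Q = \<Phi>\<^sub>Z\<^sub>\<bar>\<close> on \<open>U\<close>; these conditions determine \<open>P\<close> and \<open>Q\<close> on \<open>U\<close> uniquely.\<close>

definition wirtinger_derivatives ::
    "(nat \<Rightarrow> 'a::chilbert_space) \<Rightarrow> 'a set \<Rightarrow> ('a \<Rightarrow> 'a)
      \<Rightarrow> ('a \<Rightarrow> 'a \<Rightarrow>\<^sub>L 'a) \<Rightarrow> ('a \<Rightarrow> 'a \<Rightarrow>\<^sub>L 'a) \<Rightarrow> bool" where
  "wirtinger_derivatives e U \<Phi> P Q \<longleftrightarrow>
     (\<forall>Z\<in>U. complex_linear (P Z) \<and> complex_linear (Q Z) \<and>
        (\<Phi> has_derivative (\<lambda>u. P Z u + Q Z (conj_vec e u))) (at Z))"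

definition is_domain :: "'a::topological_space set \<Rightarrow> bool" where
  "is_domain G \<longleftrightarrow> open G \<and> connected G \<and> G \<noteq> {}"

end

theory Submission imports Defs begin

text \<open>Smallness of \<open>Q P\<inverse>\<close>, with \<open>P\<close> conjugated, makes \<open>\<Phi>\<close> a local near-isometry:
  since \<open>\<omega>\<close> is preserved,
  \<open>\<parallel>u\<parallel>\<^sup>2 = \<omega>(d\<Phi> u, d\<Phi> (\<i>u)) \<le> \<parallel>Pu + Qu'\<parallel> \<parallel>Pu - Qu'\<parallel>\<close> with \<open>u'\<close> the conjugate of \<open>u\<close>, and
  \<open>\<parallel>Qu'\<parallel> \<le> \<epsilon> \<parallel>Pu\<parallel>\<close>, so \<open>\<parallel>u\<parallel> \<le> K \<parallel>d\<Phi> u\<parallel>\<close> with \<open>K\<^sup>2 = (1 + \<epsilon>) / (1 - \<epsilon>)\<close>. Lifting segments through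
  \<open>\<Phi>\<close> then shows that \<open>G\<close> contains the ball of radius \<open>r / K\<close> about \<open>\<Phi> 0\<close>, and a cylinder of radius
  \<open>R\<close> contains no ball of radius larger than \<open>R\<close>.\<close>

section \<open>Complex scalars and the real inner product\<close>

lemma norm_scaleC: "norm (c *\<^sub>C (x::'a::complex_inner)) = cmod c * norm x"
proof -
  have "cinner (c *\<^sub>C x) (c *\<^sub>C x) = c * cnj c * cinner x x"
    using cinner_commute[of x "c *\<^sub>C x"] cinner_commute[of x x]
    by (simp add: cinner_scaleC_left)
  then have "inner (c *\<^sub>C x) (c *\<^sub>C x) = (cmod c)\<^sup>2 * inner x x"
    by (simp add: Re_cinner[symmetric] complex_mult_cnj cmod_power2)
  then have "(norm (c *\<^sub>C x))\<^sup>2 = (cmod c * norm x)\<^sup>2"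
    by (simp add: power2_norm_eq_inner power_mult_distrib)
  then show ?thesis
    by (simp add: power2_eq_iff_nonneg)
qed

lemma scaleC_scaleR: "c *\<^sub>C (a *\<^sub>R (x::'a::complex_inner)) = a *\<^sub>R (c *\<^sub>C x)"
  by (simp add: scaleC_of_real[symmetric] scaleC_scaleC mult.commute)

lemma bounded_linear_scaleC: "bounded_linear (\<lambda>x::'a::complex_inner. c *\<^sub>C x)"
  by (rule bounded_linear_intro[of _ "cmod c"])
    (simp_all add: scaleC_add_right scaleC_scaleR norm_scaleC mult.commute)

lemma scaleC_minus_right: "c *\<^sub>C (- (x::'a::complex_inner)) = - (c *\<^sub>C x)"
  by (rule linear_neg[OF bounded_linear.linear[OF bounded_linear_scaleC]])

lemma scaleC_diff_right: "c *\<^sub>C ((x::'a::complex_inner) - y) = c *\<^sub>C x - c *\<^sub>C y"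
  by (rule linear_diff[OF bounded_linear.linear[OF bounded_linear_scaleC]])

lemma scaleC_ii_ii: "\<i> *\<^sub>C \<i> *\<^sub>C (x::'a::complex_inner) = - x"
  using scaleC_of_real[of "-1" x] by (simp add: scaleC_scaleC)

lemma scaleC_uminus_left: "(- c) *\<^sub>C (x::'a::complex_inner) = - (c *\<^sub>C x)"
  using scaleC_scaleC[of "-1" c x] scaleC_of_real[of "-1" "c *\<^sub>C x"] by simp

lemma cinner_scaleC_right: "cinner (x::'a::complex_inner) (c *\<^sub>C y) = cnj c * cinner x y"
  by (metis cinner_commute cinner_scaleC_left complex_cnj_mult)

lemma Im_cinner: "Im (cinner (x::'a::complex_inner) y) = inner x (\<i> *\<^sub>C y)"
  by (simp add: Re_cinner[symmetric] cinner_scaleC_right)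

lemma symplectic_form_inner: "symplectic_form (x::'a::chilbert_space) y = - inner x (\<i> *\<^sub>C y)"
  by (simp add: symplectic_form_def Im_cinner)

lemma inner_scaleC_ii: "inner (\<i> *\<^sub>C (x::'a::complex_inner)) (\<i> *\<^sub>C y) = inner x y"
  by (simp add: Re_cinner[symmetric] cinner_scaleC_right cinner_scaleC_left)

lemma cinner_inner: "cinner (x::'a::complex_inner) y = Complex (inner x y) (inner x (\<i> *\<^sub>C y))"
  by (simp add: complex_eq_iff Re_cinner Im_cinner)

lemma bounded_linear_cinner_left: "bounded_linear (\<lambda>x::'a::complex_inner. cinner x y)"
proof -
  have "bounded_linear (\<lambda>x::'a. complex_of_real (inner x y) + \<i> * complex_of_real (inner x (\<i> *\<^sub>C y)))"
    by (intro bounded_linear_add bounded_linear_const_mult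
        bounded_linear_compose[OF bounded_linear_of_real] bounded_linear_inner_left)
  then show ?thesis
    by (simp add: cinner_inner Complex_eq)
qed

section \<open>Orthonormal expansions and coordinatewise conjugation\<close>

lemma orthonormal_basisD:
  assumes "orthonormal_basis e"
  shows "cinner (e i) (e j) = (if i = j then 1 else 0)"
    and "(\<lambda>j. cinner Z (e j) *\<^sub>C e j) sums Z"
  using assms by (auto simp: orthonormal_basis_def)

lemma norm_sum_orthonormal:
  assumes "orthonormal_basis e"
  shows "(norm (\<Sum>j\<in>{m..<n}. a j *\<^sub>C e j))\<^sup>2 = (\<Sum>j\<in>{m..<n}. (cmod (a j))\<^sup>2)"
proof -
  have inn: "inner (a i *\<^sub>C e i) (a j *\<^sub>C e j) = (if i = j then (cmod (a i))\<^sup>2 else 0)" for i j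
    by (auto simp: Re_cinner[symmetric] cinner_scaleC_left cinner_scaleC_right
        orthonormal_basisD[OF assms] cmod_power2 simp flip: power2_eq_square)
  show ?thesis
    by (simp add: power2_norm_eq_inner inner_sum_left inner_sum_right inn)
qed

lemma norm_sum_orthonormal_cong:
  assumes "orthonormal_basis e" and "\<And>j. cmod (a j) = cmod (b j)"
  shows "norm (\<Sum>j\<in>{m..<n}. a j *\<^sub>C e j) = norm (\<Sum>j\<in>{m..<n}. b j *\<^sub>C e j)"
  using norm_sum_orthonormal[OF assms(1), of a m n] norm_sum_orthonormal[OF assms(1), of b m n]
  by (simp add: assms(2) flip: power2_eq_iff_nonneg)

text \<open>Conjugating coefficients keeps the norm of every finite block of the expansion, so the
  partial sums have the same mutual distances as those of \<open>Z\<close>. They are therefore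
  Cauchy, and completeness gives the convergence that makes the \<open>suminf\<close> in
  \<open>conj_vec\<close> meaningful.\<close>

lemma conj_vec_sums:
  assumes "orthonormal_basis e"
  shows "(\<lambda>j. cnj (cinner Z (e j)) *\<^sub>C e j) sums conj_vec e Z"
proof -
  define S where "S n = (\<Sum>j<n. cinner Z (e j) *\<^sub>C e j)" for n
  define T where "T n = (\<Sum>j<n. cnj (cinner Z (e j)) *\<^sub>C e j)" for n
  have dist: "dist (T m) (T n) = dist (S m) (S n)" for m n
  proof -
    have *: "dist (T m) (T n) = dist (S m) (S n)" if "m \<le> n" for m n
    proof -
      have "norm (T n - T m) = norm (S n - S m)"
        using norm_sum_orthonormal_cong[OF assms, of "\<lambda>j. cnj (cinner Z (e j))" "\<lambda>j. cinner Z (e j)" m n]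
          that
        by (simp add: S_def T_def lessThan_atLeast0 sum_diff_nat_ivl)
      then show ?thesis by (simp add: dist_norm norm_minus_commute)
    qed
    show ?thesis
      using *[of m n] *[of n m] by (cases "m \<le> n") (auto simp: dist_commute)
  qed
  have "S \<longlonglongrightarrow> Z"
    using orthonormal_basisD(2)[OF assms, of Z] by (simp add: sums_def S_def[abs_def])
  then have "Cauchy S"
    by (rule LIMSEQ_imp_Cauchy)
  then have "Cauchy T"
    by (simp add: Cauchy_def dist)
  then have "convergent T"
    by (rule Cauchy_convergent)
  then show ?thesis
    unfolding conj_vec_def T_def[abs_def]
    by (intro summable_sums) (simp add: summable_iff_convergent)
qed

lemma norm_conj_vec:
  assumes "orthonormal_basis e"
  shows "norm (conj_vec e Z) = norm Z"
proof -
  have "(\<lambda>n. norm (\<Sum>j<n. cnj (cinner Z (e j)) *\<^sub>C e j)) \<longlonglongrightarrow> norm (conj_vec e Z)"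
    using conj_vec_sums[OF assms] by (intro tendsto_norm) (simp add: sums_def)
  moreover have "(\<lambda>n. norm (\<Sum>j<n. cinner Z (e j) *\<^sub>C e j)) \<longlonglongrightarrow> norm Z"
    using orthonormal_basisD(2)[OF assms] by (intro tendsto_norm) (simp add: sums_def)
  moreover have "norm (\<Sum>j<n. cnj (cinner Z (e j)) *\<^sub>C e j) = norm (\<Sum>j<n. cinner Z (e j) *\<^sub>C e j)" for n
    unfolding lessThan_atLeast0 by (rule norm_sum_orthonormal_cong[OF assms]) simp
  ultimately show ?thesis
    by (metis (no_types, lifting) LIMSEQ_unique ext)
qed

lemma conj_vec_add:
  assumes "orthonormal_basis e"
  shows "conj_vec e (x + y) = conj_vec e x + conj_vec e y"
  using sums_add[OF conj_vec_sums[OF assms, of x] conj_vec_sums[OF assms, of y]]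
    conj_vec_sums[OF assms, of "x + y"]
  by (simp add: cinner_add_left scaleC_add_left sums_unique2)

lemma conj_vec_scaleC:
  assumes "orthonormal_basis e"
  shows "conj_vec e (c *\<^sub>C x) = cnj c *\<^sub>C conj_vec e x"
  using bounded_linear.sums[OF bounded_linear_scaleC conj_vec_sums[OF assms, of x], of "cnj c"]
    conj_vec_sums[OF assms, of "c *\<^sub>C x"]
  by (simp add: cinner_scaleC_left scaleC_scaleC sums_unique2)

lemma bounded_linear_conj_vec:
  assumes "orthonormal_basis e"
  shows "bounded_linear (conj_vec e)"
proof (rule bounded_linear_intro[of _ 1])
  show "conj_vec e (a *\<^sub>R x) = a *\<^sub>R conj_vec e x" for a x
    using conj_vec_scaleC[OF assms, of "complex_of_real a" x] by (simp add: scaleC_of_real)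
qed (simp_all add: conj_vec_add norm_conj_vec assms)

lemma cinner_conj_vec:
  assumes "orthonormal_basis e"
  shows "cinner (conj_vec e Z) (e k) = cnj (cinner Z (e k))"
proof -
  have "(\<lambda>j. cinner (cnj (cinner Z (e j)) *\<^sub>C e j) (e k)) sums cinner (conj_vec e Z) (e k)"
    by (rule bounded_linear.sums[OF bounded_linear_cinner_left conj_vec_sums[OF assms]])
  moreover have "(\<lambda>j. cinner (cnj (cinner Z (e j)) *\<^sub>C e j) (e k))
      = (\<lambda>j. if j = k then cnj (cinner Z (e k)) else 0)"
    by (auto simp: cinner_scaleC_left orthonormal_basisD[OF assms])
  ultimately show ?thesis
    using sums_single[of k "\<lambda>_. cnj (cinner Z (e k))"] by (simp add: sums_unique2)
qed

lemma conj_vec_conj_vec: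
  assumes "orthonormal_basis e"
  shows "conj_vec e (conj_vec e Z) = Z"
  using conj_vec_sums[OF assms, of "conj_vec e Z"] orthonormal_basisD(2)[OF assms, of Z]
  by (simp add: cinner_conj_vec[OF assms] sums_unique2)

section \<open>Conjugated and inverse operators, and a surjectivity criterion\<close>

lemma conj_op_apply:
  assumes "orthonormal_basis e"
  shows "conj_op e T u = conj_vec e (T (conj_vec e u))"
proof -
  have "bounded_linear (\<lambda>u. conj_vec e (T (conj_vec e u)))"
    by (intro bounded_linear_compose[OF bounded_linear_conj_vec[OF assms]]
        bounded_linear_compose[OF blinfun.bounded_linear_right] bounded_linear_conj_vec assms)
  then show ?thesis
    by (simp add: conj_op_def bounded_linear_Blinfun_apply)
qed

text \<open>Being a definite description, \<open>inverse_op\<close> can be evaluated only once a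
  unique bounded two-sided inverse is known. The lower bound gives injectivity and makes the
  set-theoretic inverse norm-nonincreasing.\<close>

lemma inverse_op_left_inverse:
  fixes T :: "'a::real_normed_vector \<Rightarrow>\<^sub>L 'a"
  assumes surj: "surj (blinfun_apply T)" and below: "\<And>u. norm u \<le> norm (T u)"
  shows "inverse_op T (T u) = u"
proof -
  have inj: "inj (blinfun_apply T)"
  proof (rule injI)
    fix x y assume "T x = T y"
    then show "x = y" using below[of "x - y"] by (simp add: blinfun.diff_right)
  qed
  define S where "S = inv (blinfun_apply T)"
  have TS: "T (S y) = y" for y
    by (simp add: S_def surj surj_f_inv_f)
  have ST: "S (T x) = x" for x
    by (simp add: S_def inj)
  have S: "bounded_linear S"
  proof (rule bounded_linear_intro[of _ 1])
    show "S (x + y) = S x + S y" for x y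
      by (metis ST TS blinfun.add_right)
    show "S (a *\<^sub>R x) = a *\<^sub>R S x" for a x
      by (metis ST TS blinfun.scaleR_right)
    show "norm (S x) \<le> norm x * 1" for x
      using below[of "S x"] by (simp add: TS)
  qed
  have SB: "Blinfun S o\<^sub>L T = id_blinfun \<and> T o\<^sub>L Blinfun S = id_blinfun"
    by (intro conjI blinfun_eqI) (simp_all add: bounded_linear_Blinfun_apply[OF S] ST TS)
  have "inverse_op T = Blinfun S"
    unfolding inverse_op_def
  proof (rule the_equality)
    show "Blinfun S o\<^sub>L T = id_blinfun \<and> T o\<^sub>L Blinfun S = id_blinfun" by (rule SB)
    fix S' assume "S' o\<^sub>L T = id_blinfun \<and> T o\<^sub>L S' = id_blinfun"
    then show "S' = Blinfun S"
      using ST TS by (intro blinfun_eqI) (metis S blinfun_apply_blinfun_compose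
        blinfun_apply_id_blinfun bounded_linear_Blinfun_apply id_apply)
  qed
  then show ?thesis
    by (simp add: bounded_linear_Blinfun_apply[OF S] ST)
qed

text \<open>A Lax-Milgram argument: for small \<open>t\<close> the map
  \<open>x - t *\<^sub>R (T x - y)\<close> is a contraction, and its fixed point solves
  \<open>T x = y\<close>.\<close>

lemma coercive_surj:
  fixes T :: "'a::{real_inner,complete_space} \<Rightarrow> 'a"
  assumes T: "bounded_linear T" and coercive: "\<And>x. (norm x)\<^sup>2 \<le> inner (T x) x"
  shows "surj T"
proof -
  interpret bounded_linear T by fact
  obtain M0 where M0: "\<And>x. norm (T x) \<le> norm x * M0"
    using bounded by blast
  \<comment> \<open>Raising the bound to at least 2 ensures \<open>t < 1\<close>, so that
    \<open>1 - t\<close> is positive under the root.\<close>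
  define M where "M = max M0 2"
  have M: "norm (T x) \<le> norm x * M" "2 \<le> M" for x
    using M0[of x] mult_left_mono[of M0 M "norm x"] by (auto simp: M_def)
  \<comment> \<open>This value minimises the factor \<open>1 - 2 * t + t\<^sup>2 * M\<^sup>2\<close>
    that bounds the squared contraction rate; the minimum is \<open>1 - t\<close>.\<close>
  define t where "t = 1 / M\<^sup>2"
  define c where "c = sqrt (1 - t)"
  have t: "0 < t" "t < 1"
    using M(2) by (auto simp: t_def one_less_power)
  have c: "0 \<le> c" "c < 1"
    using t by (auto simp: c_def)
  have contr: "norm (x - t *\<^sub>R T x) \<le> c * norm x" for x
  proof -
    have "t\<^sup>2 * (norm (T x))\<^sup>2 \<le> t\<^sup>2 * (norm x * M)\<^sup>2"
      using M(1)[of x] by (intro mult_left_mono power_mono) auto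
    also have "\<dots> = t * (norm x)\<^sup>2"
      using M(2) by (simp add: t_def power2_eq_square)
    finally have quadratic: "t\<^sup>2 * (norm (T x))\<^sup>2 \<le> t * (norm x)\<^sup>2" .
    have "(norm (x - t *\<^sub>R T x))\<^sup>2 = (norm x)\<^sup>2 - 2 * (t * inner (T x) x) + t\<^sup>2 * (norm (T x))\<^sup>2"
      unfolding power2_norm_eq_inner
      by (simp add: inner_diff_left inner_diff_right inner_commute power2_eq_square)
    also have "\<dots> \<le> (1 - t) * (norm x)\<^sup>2"
      using mult_left_mono[OF coercive[of x], of t] t quadratic
      unfolding left_diff_distrib by linarith
    also have "\<dots> = (c * norm x)\<^sup>2"
      using t by (simp add: c_def power_mult_distrib)
    finally show ?thesis
      by (rule power2_le_imp_le) (use c in simp)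
  qed
  show ?thesis
  proof (unfold surj_def, intro allI)
    fix y
    have "\<exists>!x\<in>UNIV. x - t *\<^sub>R (T x - y) = x"
    proof (rule Banach_fix[OF _ _ c])
      show "complete (UNIV::'a set)"
        by (simp add: complete_UNIV)
      fix u v :: 'a
      have "dist (u - t *\<^sub>R (T u - y)) (v - t *\<^sub>R (T v - y)) = norm ((u - v) - t *\<^sub>R T (u - v))"
        by (simp add: dist_norm diff algebra_simps)
      also have "\<dots> \<le> c * dist u v"
        using contr[of "u - v"] by (simp add: dist_norm)
      finally show "dist (u - t *\<^sub>R (T u - y)) (v - t *\<^sub>R (T v - y)) \<le> c * dist u v" .
    qed auto
    then obtain x where "x - t *\<^sub>R (T x - y) = x" by blast
    then have "y = T x" using t by simp
    then show "\<exists>x. y = T x" ..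
  qed
qed


section \<open>Linear symplectic maps and their complex-linear parts\<close>

text \<open>With \<open>x\<close> and \<open>y\<close> as in the proof, invariance of the form on
  the pair u, iu says that the squared norm of \<open>u\<close> is \<open>- inner x y\<close>.
  Polarization turns this into the squared norm of (x - y)/2 minus that of (x + y)/2; for
  real-linear \<open>D\<close> these are the complex-linear and antilinear parts.\<close>

lemma symplectic_complex_part_expanding:
  fixes D :: "'a::chilbert_space \<Rightarrow> 'a"
  assumes "\<And>u v. symplectic_form (D u) (D v) = symplectic_form u v"
  shows "norm u \<le> norm ((1/2) *\<^sub>R (D u - \<i> *\<^sub>C D (\<i> *\<^sub>C u)))"
proof (rule power2_le_imp_le)
  define x y where "x = D u" and "y = \<i> *\<^sub>C D (\<i> *\<^sub>C u)"
  have "(norm u)\<^sup>2 = - inner x y"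
    using assms[of u "\<i> *\<^sub>C u"]
    by (simp add: symplectic_form_inner scaleC_ii_ii power2_norm_eq_inner x_def y_def)
  also have "\<dots> \<le> - inner x y + inner (x + y) (x + y) / 4"
    by simp
  also have "\<dots> = inner ((1/2) *\<^sub>R (x - y)) ((1/2) *\<^sub>R (x - y))"
    by (simp add: inner_diff_left inner_diff_right inner_add_left inner_add_right inner_commute
        field_simps)
  finally show "(norm u)\<^sup>2 \<le> (norm ((1/2) *\<^sub>R (D u - \<i> *\<^sub>C D (\<i> *\<^sub>C u))))\<^sup>2"
    by (simp only: power2_norm_eq_inner x_def y_def)
qed simp

text \<open>Invariance together with \<open>D (E w) = w\<close> shows that the real adjoint of
  \<open>D\<close> sends w to -i E(iw). Taking complex-linear parts therefore exchanges
  \<open>D\<close> and \<open>E\<close> under the adjoint.\<close>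

lemma symplectic_adjoint:
  fixes D E :: "'a::chilbert_space \<Rightarrow> 'a"
  assumes symp: "\<And>u v. symplectic_form (D u) (D v) = symplectic_form u v"
    and DE: "\<And>u. D (E u) = u" and E: "bounded_linear E"
  shows "inner ((1/2) *\<^sub>R (D u - \<i> *\<^sub>C D (\<i> *\<^sub>C u))) w
    = inner u ((1/2) *\<^sub>R (E w - \<i> *\<^sub>C E (\<i> *\<^sub>C w)))"
proof -
  have sw: "inner (D u) (\<i> *\<^sub>C w) = inner u (\<i> *\<^sub>C E w)" for u w
    using symp[of u "E w"] by (simp add: symplectic_form_inner DE)
  have "inner (D u) w = - inner u (\<i> *\<^sub>C E (\<i> *\<^sub>C w))"
    using sw[of u "- (\<i> *\<^sub>C w)"]
    by (simp add: scaleC_minus_right scaleC_ii_ii linear_neg[OF bounded_linear.linear[OF E]])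
  moreover have "inner (\<i> *\<^sub>C D (\<i> *\<^sub>C u)) w = - inner u (E w)"
    using sw[of "\<i> *\<^sub>C u" w] inner_scaleC_ii[of "\<i> *\<^sub>C D (\<i> *\<^sub>C u)" w]
    by (simp add: scaleC_ii_ii inner_scaleC_ii)
  ultimately show ?thesis
    by (simp add: inner_diff_left inner_diff_right)
qed

text \<open>\<open>P\<close> commutes with i, while \<open>Q\<close> after conjugation anticommutes
  with it. This identifies the combinations in the two preceding lemmas.\<close>

lemma wirtinger_parts:
  fixes P Q :: "'a::chilbert_space \<Rightarrow>\<^sub>L 'a"
  assumes e: "orthonormal_basis e" and "complex_linear P" "complex_linear Q"
    and D: "\<And>u. D u = P u + Q (conj_vec e u)"
  shows "\<i> *\<^sub>C D (\<i> *\<^sub>C u) = Q (conj_vec e u) - P u"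
    and "(1/2) *\<^sub>R (D u - \<i> *\<^sub>C D (\<i> *\<^sub>C u)) = P u"
proof -
  show *: "\<i> *\<^sub>C D (\<i> *\<^sub>C u) = Q (conj_vec e u) - P u"
    using assms(2,3)
    by (simp add: D complex_linear_def conj_vec_scaleC[OF e] scaleC_add_right scaleC_ii_ii
        scaleC_uminus_left scaleC_minus_right scaleC_diff_right blinfun.minus_right)
  show "(1/2) *\<^sub>R (D u - \<i> *\<^sub>C D (\<i> *\<^sub>C u)) = P u"
    unfolding * by (simp add: D flip: scaleR_2)
qed

text \<open>The complex-linear part of \<open>D\<inverse>\<close> is the adjoint of \<open>P\<close>, and both are bounded below by \<open>1\<close>,
  so \<open>P P\<^sup>*\<close> is coercive and hence onto.\<close>

lemma symplectic_complex_part_invertible: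
  fixes P Q :: "'a::chilbert_space \<Rightarrow>\<^sub>L 'a"
  assumes e: "orthonormal_basis e" and PQ: "complex_linear P" "complex_linear Q"
    and D: "\<And>u. D u = P u + Q (conj_vec e u)"
    and symp: "\<And>u v. symplectic_form (D u) (D v) = symplectic_form u v"
    and DE: "\<And>u. D (E u) = u" and E: "bounded_linear E"
  shows "norm u \<le> norm (P u)" and "surj (blinfun_apply P)"
proof -
  note parts = wirtinger_parts[OF e PQ D]
  define P' where "P' w = (1/2) *\<^sub>R (E w - \<i> *\<^sub>C E (\<i> *\<^sub>C w))" for w
  have P': "bounded_linear P'"
    unfolding P'_def
    by (intro bounded_linear_const_scaleR bounded_linear_sub E
        bounded_linear_compose[OF bounded_linear_scaleC] bounded_linear_compose[OF E]
        bounded_linear_scaleC)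
  have symp': "symplectic_form (E u) (E v) = symplectic_form u v" for u v
    using symp[of "E u" "E v"] by (simp add: DE)
  have below': "norm w \<le> norm (P' w)" for w
    unfolding P'_def by (rule symplectic_complex_part_expanding) (rule symp')
  show "norm u \<le> norm (P u)"
    using symplectic_complex_part_expanding[of D u, OF symp] unfolding parts(2) .
  have adj: "inner (P u) w = inner u (P' w)" for u w
    using symplectic_adjoint[OF symp DE E, of u w] unfolding parts(2) P'_def .
  have "surj (\<lambda>w. P (P' w))"
  proof (rule coercive_surj)
    show "bounded_linear (\<lambda>w. P (P' w))"
      by (rule bounded_linear_compose[OF blinfun.bounded_linear_right P'])
    show "(norm x)\<^sup>2 \<le> inner (P (P' x)) x" for x
      unfolding adj power2_norm_eq_inner[symmetric] by (rule power_mono[OF below']) simp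
  qed
  then show "surj (blinfun_apply P)"
    unfolding surj_def by blast
qed

lemma symplectic_expansion_bound:
  fixes P Q :: "'a::chilbert_space \<Rightarrow>\<^sub>L 'a"
  assumes e: "orthonormal_basis e" and PQ: "complex_linear P" "complex_linear Q"
    and D: "\<And>u. D u = P u + Q (conj_vec e u)"
    and symp: "\<And>u v. symplectic_form (D u) (D v) = symplectic_form u v"
    and DE: "\<And>u. D (E u) = u" and E: "bounded_linear E"
    and small: "norm (Q o\<^sub>L inverse_op (conj_op e P)) \<le> \<epsilon>" and \<epsilon>: "\<epsilon> < 1"
  shows "norm u \<le> sqrt ((1 + \<epsilon>) / (1 - \<epsilon>)) * norm (D u)"
proof -
  note inv = symplectic_complex_part_invertible[OF e PQ D symp DE E]
  have \<epsilon>0: "0 \<le> \<epsilon>"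
    using small norm_ge_zero order_trans by blast
  \<comment> \<open>Conjugation is an isometric involution, so surjectivity and the lower bound pass
    from \<open>P\<close> to \<open>conj_op e P\<close>, and \<open>inverse_op\<close> can be
    evaluated there.\<close>
  have "surj (blinfun_apply (conj_op e P))"
  proof (unfold surj_def, intro allI)
    fix y
    obtain x where "P x = conj_vec e y"
      using inv(2) by (metis surjD)
    then have "y = conj_op e P (conj_vec e x)"
      by (simp add: conj_op_apply[OF e] conj_vec_conj_vec[OF e])
    then show "\<exists>x. y = conj_op e P x" ..
  qed
  moreover have "norm x \<le> norm (conj_op e P x)" for x
    using inv(1)[of "conj_vec e x"] by (simp add: conj_op_apply[OF e] norm_conj_vec[OF e])
  ultimately have linv: "inverse_op (conj_op e P) (conj_op e P x) = x" for x
    by (rule inverse_op_left_inverse)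
  \<comment> \<open>The conjugate of \<open>P u\<close> is \<open>conj_op e P\<close> applied to the
    conjugate of \<open>u\<close>, so the inverse recovers the argument of \<open>Q\<close>.\<close>
  have "Q (conj_vec e u) = (Q o\<^sub>L inverse_op (conj_op e P)) (conj_vec e (P u))"
    using linv[of "conj_vec e u"] by (simp add: conj_op_apply[OF e] conj_vec_conj_vec[OF e])
  then have "norm (Q (conj_vec e u)) \<le> norm (Q o\<^sub>L inverse_op (conj_op e P)) * norm (conj_vec e (P u))"
    by (metis norm_blinfun)
  also have "\<dots> \<le> \<epsilon> * norm (P u)"
    using small by (simp add: norm_conj_vec[OF e] mult_right_mono)
  finally have QP: "norm (Q (conj_vec e u)) \<le> \<epsilon> * norm (P u)" .
  have 1: "norm (\<i> *\<^sub>C D (\<i> *\<^sub>C u)) \<le> (1 + \<epsilon>) * norm (P u)"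
    unfolding wirtinger_parts(1)[OF e PQ D]
    using norm_triangle_ineq4[of "Q (conj_vec e u)" "P u"] QP by (simp add: algebra_simps)
  have 2: "(1 - \<epsilon>) * norm (P u) \<le> norm (D u)"
    unfolding D
    using norm_diff_ineq[of "P u" "Q (conj_vec e u)"] QP by (simp add: algebra_simps)
  \<comment> \<open>Invariance on u, iu again; after Cauchy-Schwarz, the facts \<open>1\<close> and
    \<open>2\<close> trade the second factor for a multiple of \<open>norm (D u)\<close>.\<close>
  have "(norm u)\<^sup>2 = inner (D u) (- (\<i> *\<^sub>C D (\<i> *\<^sub>C u)))"
    using symp[of u "\<i> *\<^sub>C u"]
    by (simp add: symplectic_form_inner scaleC_ii_ii power2_norm_eq_inner)
  also have "\<dots> \<le> norm (D u) * norm (\<i> *\<^sub>C D (\<i> *\<^sub>C u))"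
    by (metis norm_cauchy_schwarz norm_minus_cancel)
  also have "\<dots> \<le> norm (D u) * ((1 + \<epsilon>) * (norm (D u) / (1 - \<epsilon>)))"
    using 1 2 \<epsilon> \<epsilon>0
    by (intro mult_left_mono order_trans[OF 1]) (auto simp: field_simps)
  also have "\<dots> = (sqrt ((1 + \<epsilon>) / (1 - \<epsilon>)) * norm (D u))\<^sup>2"
    using \<epsilon> \<epsilon>0 by (simp add: power_mult_distrib) (simp add: power2_eq_square)
  finally show ?thesis
    by (rule power2_le_imp_le) (use \<epsilon> \<epsilon>0 in auto)
qed

section \<open>Balls covered by the image of a map with Lipschitz inverse\<close>

text \<open>The lift of the segment from \<open>\<Phi> 0\<close> to \<open>\<Phi> 0 + w\<close>
  starts at 0 with speed at most \<open>K * norm w < r\<close>. It converges inside the ball up to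
  the first exit time from \<open>V\<close>, and \<open>\<Phi>\<close> maps the limit to the exit
  point, which would then lie in \<open>V\<close>.\<close>

lemma lipschitz_inverse_covers_ball:
  fixes \<Phi> :: "'a::{real_normed_vector,complete_space} \<Rightarrow> 'b::real_normed_vector"
  assumes bij: "bij_betw \<Phi> (ball 0 r) V" and "open V" and cont: "continuous_on (ball 0 r) \<Phi>"
    and der: "\<And>x. x \<in> V \<Longrightarrow> (inv_into (ball 0 r) \<Phi> has_derivative E x) (at x)"
    and K: "\<And>x. x \<in> V \<Longrightarrow> onorm (E x) \<le> K"
    and r: "0 < r" and w: "K * norm w < r"
  shows "\<Phi> 0 + w \<in> V"
proof (rule ccontr)
  assume w_out: "\<Phi> 0 + w \<notin> V"
  define l where "l t = \<Phi> 0 + t *\<^sub>R w" for t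
  define C where "C = {0..1} \<inter> l -` (- V)"
  have l: "continuous_on S l" for S
    unfolding l_def by (intro continuous_intros)
  have "closed C"
    unfolding C_def using \<open>open V\<close> by (intro continuous_closed_preimage l) auto
  have p: "\<Phi> 0 \<in> V"
    using bij r by (auto simp: bij_betw_def)
  have "1 \<in> C"
    using w_out by (simp add: C_def l_def)
  have bdd: "bdd_below C"
    by (rule bdd_belowI[of _ 0]) (auto simp: C_def)
  \<comment> \<open>The first exit time, attained because \<open>C\<close> is closed.\<close>
  define \<tau> where "\<tau> = Inf C"
  have "\<tau> \<in> C"
    unfolding \<tau>_def using \<open>closed C\<close> \<open>1 \<in> C\<close> bdd by (intro closed_contains_Inf) auto
  then have \<tau>: "0 \<le> \<tau>" "\<tau> \<le> 1" "l \<tau> \<notin> V"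
    by (auto simp: C_def)
  have "\<tau> \<noteq> 0"
    using \<tau>(3) p by (auto simp: l_def)
  with \<tau> have \<tau>0: "0 < \<tau>" by simp
  have l_in: "l t \<in> V" if "t \<in> {0..<\<tau>}" for t
  proof (rule ccontr)
    assume "l t \<notin> V"
    then have "t \<in> C" using that \<tau> by (auto simp: C_def)
    then have "\<tau> \<le> t" unfolding \<tau>_def using bdd by (rule cInf_lower)
    then show False using that by simp
  qed
  define \<gamma> where "\<gamma> t = inv_into (ball 0 r) \<Phi> (l t)" for t
  have \<Phi>\<gamma>: "\<Phi> (\<gamma> t) = l t" if "t \<in> {0..<\<tau>}" for t
    using bij_betw_inv_into_right[OF bij l_in[OF that]] by (simp add: \<gamma>_def)
  have \<gamma>0: "\<gamma> 0 = 0"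
    using bij_betw_inv_into_left[OF bij, of 0] r by (simp add: \<gamma>_def l_def)
  define L where "L = K * norm w"
  have K0: "0 \<le> K"
    using onorm_pos_le[OF has_derivative_bounded_linear[OF der[OF p]]] K[OF p] by simp
  then have L0: "0 \<le> L" by (simp add: L_def)
  have lip: "norm (\<gamma> t - \<gamma> s) \<le> L * norm (t - s)" if "t \<in> {0..<\<tau>}" "s \<in> {0..<\<tau>}" for s t
  proof (rule differentiable_bound[where S = "{0..<\<tau>}" and f' = "\<lambda>t h. E (l t) (h *\<^sub>R w)"])
    fix t assume t: "t \<in> {0..<\<tau>}"
    have "(l has_derivative (\<lambda>h. h *\<^sub>R w)) (at t within {0..<\<tau>})"
      unfolding l_def by (auto intro!: derivative_eq_intros)
    then show "(\<gamma> has_derivative (\<lambda>h. E (l t) (h *\<^sub>R w))) (at t within {0..<\<tau>})"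
      unfolding \<gamma>_def by (rule has_derivative_compose) (rule der[OF l_in[OF t]])
    show "onorm (\<lambda>h. E (l t) (h *\<^sub>R w)) \<le> L"
    proof (rule onorm_le)
      fix h :: real
      have "norm (E (l t) (h *\<^sub>R w)) \<le> onorm (E (l t)) * norm (h *\<^sub>R w)"
        by (rule onorm[OF has_derivative_bounded_linear[OF der[OF l_in[OF t]]]])
      also have "\<dots> \<le> K * norm (h *\<^sub>R w)"
        using K[OF l_in[OF t]] by (rule mult_right_mono) simp
      finally show "norm (E (l t) (h *\<^sub>R w)) \<le> L * norm h"
        by (simp add: L_def mult_ac)
    qed
  qed (use that in auto)
  \<comment> \<open>At \<open>\<tau>\<close> itself \<open>inv_into\<close> has no meaningful value,
    as \<open>l \<tau>\<close> is outside \<open>V\<close>. The endpoint of the lift comes instead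
    from uniform continuity on the half-open interval and completeness.\<close>
  have "L-lipschitz_on {0..<\<tau>} \<gamma>"
    using lip L0 by (intro lipschitz_onI) (auto simp: dist_norm)
  then have "uniformly_continuous_on {0..<\<tau>} \<gamma>"
    by (rule lipschitz_on_uniformly_continuous)
  moreover have cl: "\<tau> \<in> closure {0..<\<tau>}"
    using \<tau>0 by (simp add: closure_atLeastLessThan)
  ultimately obtain z where z: "(\<gamma> \<longlongrightarrow> z) (at \<tau> within {0..<\<tau>})"
    by (rule uniformly_continuous_on_extension_at_closure)
  have nt: "at \<tau> within {0..<\<tau>} \<noteq> bot"
    using cl by (simp add: at_within_eq_bot_iff)
  have "norm z \<le> L"
  proof (rule tendsto_upperbound[OF tendsto_norm[OF z] _ nt])
    have "norm (\<gamma> t) \<le> L" if "t \<in> {0..<\<tau>}" for t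
    proof -
      have "norm (\<gamma> t) \<le> L * t"
        using lip[OF that, of 0] that \<gamma>0 \<tau>0 by simp
      also have "\<dots> \<le> L * 1"
        using that \<tau> L0 by (intro mult_left_mono) auto
      finally show ?thesis by simp
    qed
    then show "\<forall>\<^sub>F t in at \<tau> within {0..<\<tau>}. norm (\<gamma> t) \<le> L"
      by (auto simp: eventually_at_filter)
  qed
  then have z_in: "z \<in> ball 0 r"
    using w by (simp add: L_def)
  then have "isCont \<Phi> z"
    using cont continuous_on_eq_continuous_at[OF open_ball] by blast
  then have "((\<lambda>t. \<Phi> (\<gamma> t)) \<longlongrightarrow> \<Phi> z) (at \<tau> within {0..<\<tau>})"
    using z by (rule isCont_tendsto_compose)
  then have "(l \<longlongrightarrow> \<Phi> z) (at \<tau> within {0..<\<tau>})"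
    by (rule Lim_transform_eventually) (auto simp: eventually_at_filter \<Phi>\<gamma>)
  moreover have "(l \<longlongrightarrow> l \<tau>) (at \<tau> within {0..<\<tau>})"
    unfolding l_def by (intro tendsto_intros)
  ultimately have "\<Phi> z = l \<tau>"
    using nt by (intro tendsto_unique)
  then show False
    using \<tau>(3) z_in bij by (metis bij_betwE)
qed

section \<open>Comparing the covered ball with the cylinder\<close>

theorem theorem6p1:
  fixes e :: "nat \<Rightarrow> 'a::chilbert_space" and r R :: real and G :: "'a set"
  assumes "orthonormal_basis e"
    and "0 < r" and "0 < R"
    and "is_domain G"
    and "G \<subseteq> {Z. cmod (cinner Z (e 0)) < R}"
  shows "\<exists>\<epsilon>\<^sub>0>0.
    (\<exists>\<Phi> P Q.
        symplectomorphism (ball 0 r) G \<Phi> \<and>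
        wirtinger_derivatives e (ball 0 r) \<Phi> P Q \<and>
        C1_on (ball 0 r) (\<lambda>Z. Q Z o\<^sub>L inverse_op (conj_op e (P Z))) \<and>
        C1_norm (ball 0 r) (\<lambda>Z. Q Z o\<^sub>L inverse_op (conj_op e (P Z))) \<le> ennreal \<epsilon>\<^sub>0)
    \<longrightarrow> r \<le> R"
\<comment> \<open>The constant may depend on \<open>r\<close> and \<open>R\<close>: any positive one
  serves if \<open>r \<le> R\<close>, and otherwise it is chosen so small that no such
  \<open>\<Phi>\<close> exists.\<close>
proof (cases "r \<le> R")
  case True
  then show ?thesis by (intro exI[of _ 1]) auto
next
  case False
  \<comment> \<open>the solution of \<open>(1 + \<epsilon>) / (1 - \<epsilon>) = r / R\<close>\<close>
  define \<epsilon> where "\<epsilon> = (r - R) / (r + R)"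
  have \<epsilon>: "0 < \<epsilon>" "\<epsilon> < 1"
    using False assms by (auto simp: \<epsilon>_def)
  have "1 + \<epsilon> = 2 * r / (r + R)" "1 - \<epsilon> = 2 * R / (r + R)"
    using assms by (auto simp: \<epsilon>_def field_simps)
  then have ratio: "(1 + \<epsilon>) / (1 - \<epsilon>) = r / R"
    using assms by simp
  \<comment> \<open>The expansion constant for this \<open>\<epsilon>\<close>. The covered radius
    \<open>r / K\<close> is the geometric mean of \<open>r\<close> and \<open>R\<close>, hence
    exceeds \<open>R\<close>.\<close>
  define K where "K = sqrt (r / R)"
  have "1 < r / R"
    using False assms by simp
  then have "1 < K"
    by (simp add: K_def)
  then have "K * R < K * K * R"
    using assms by simp
  also have "K * K = r / R"
    using assms by (simp add: K_def)
  also have "r / R * R = r"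
    using assms by simp
  finally have KR: "K * R < r" .
  have False
    if symp: "symplectomorphism (ball 0 r) G \<Phi>"
      and wirt: "wirtinger_derivatives e (ball 0 r) \<Phi> P Q"
      and small: "C1_norm (ball 0 r) (\<lambda>Z. Q Z o\<^sub>L inverse_op (conj_op e (P Z))) \<le> ennreal \<epsilon>"
    for \<Phi> P Q
  proof -
    define \<Psi> where "\<Psi> = inv_into (ball 0 r) \<Phi>"
    have bij: "bij_betw \<Phi> (ball 0 r) G" and "open G" and "C1_on G \<Psi>"
      using symp by (auto simp: symplectomorphism_def \<Psi>_def)
    then obtain E :: "'a \<Rightarrow> 'a \<Rightarrow>\<^sub>L 'a" where E: "\<And>x. x \<in> G \<Longrightarrow> (\<Psi> has_derivative E x) (at x)"
      by (auto simp: C1_on_def)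
    define D where "D Z u = P Z u + Q Z (conj_vec e u)" for Z u
    have PQ: "complex_linear (P Z)" "complex_linear (Q Z)"
      and D: "(\<Phi> has_derivative D Z) (at Z)" if "Z \<in> ball 0 r" for Z
      using wirt that by (auto simp: wirtinger_derivatives_def D_def[abs_def])
    have D_symp: "symplectic_form (D Z u) (D Z v) = symplectic_form u v" if "Z \<in> ball 0 r" for Z u v
      using symp that frechet_derivative_at[OF D[OF that]] by (simp add: symplectomorphism_def)
    have A: "norm (Q Z o\<^sub>L inverse_op (conj_op e (P Z))) \<le> \<epsilon>" if "Z \<in> ball 0 r" for Z
    proof -
      have "ennreal (norm (Q Z o\<^sub>L inverse_op (conj_op e (P Z)))) \<le> ennreal \<epsilon>"
        using small that by (auto simp: C1_norm_def SUP_le_iff)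
      then show ?thesis
        using \<epsilon> by simp
    qed
    have K: "onorm (E x) \<le> K" if x: "x \<in> G" for x
    proof -
      have Z: "\<Psi> x \<in> ball 0 r" and \<Phi>\<Psi>: "\<And>y. y \<in> G \<Longrightarrow> \<Phi> (\<Psi> y) = y"
        using bij x bij_betwE[OF bij_betw_inv_into[OF bij]] bij_betw_inv_into_right[OF bij]
        by (auto simp: \<Psi>_def)
      \<comment> \<open>Differentiating the identity on the open set \<open>G\<close> makes
        \<open>E x\<close> a right inverse of \<open>D (\<Psi> x)\<close>, so the expansion bound
        for \<open>D\<close> becomes a norm bound for \<open>E x\<close>.\<close>
      have "((\<lambda>y. \<Phi> (\<Psi> y)) has_derivative (\<lambda>u. D (\<Psi> x) (E x u))) (at x)"
        by (rule has_derivative_compose[OF E[OF x] D[OF Z]])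
      then have "((\<lambda>y. y) has_derivative (\<lambda>u. D (\<Psi> x) (E x u))) (at x)"
        by (rule has_derivative_transform_within_open[OF _ \<open>open G\<close> x]) (rule \<Phi>\<Psi>)
      then have "(\<lambda>u. D (\<Psi> x) (E x u)) = (\<lambda>u. u)"
        using has_derivative_ident by (rule has_derivative_unique)
      then have DE: "D (\<Psi> x) (E x u) = u" for u
        by metis
      have E_le: "norm (E x u) \<le> K * norm u" for u
        using symplectic_expansion_bound[OF assms(1) PQ[OF Z] D_def D_symp[OF Z] DE
            blinfun.bounded_linear_right A[OF Z] \<epsilon>(2), of "E x u"]
        by (simp add: DE ratio K_def)
      show ?thesis
        by (rule onorm_bound[OF _ E_le]) (use \<open>1 < K\<close> in simp)
    qed
    have "continuous_on (ball 0 r) \<Phi>"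
      using D by (intro continuous_at_imp_continuous_on ballI has_derivative_continuous)
    note covers = lipschitz_inverse_covers_ball[OF bij \<open>open G\<close> this E[unfolded \<Psi>_def] K assms(2)]
    define c where "c = cinner (\<Phi> 0) (e 0)"
    \<comment> \<open>The phase of \<open>c\<close>, with 1 as default at 0. Moving by
      \<open>R\<close> in this direction raises the modulus of the first coordinate to
      \<open>cmod c + R\<close>, which is outside the open cylinder.\<close>
    define s where "s = (if c = 0 then 1 else sgn c)"
    have s: "cmod s = 1" "c = of_real (cmod c) * s"
      by (auto simp: s_def sgn_eq norm_divide)
    define w where "w = (of_real R * s) *\<^sub>C e 0"
    have "norm (e 0) = 1"
      using orthonormal_basisD(1)[OF assms(1), of 0 0]
      by (simp add: norm_eq_sqrt_inner Re_cinner[symmetric])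
    then have "norm w = R"
      using assms s(1) by (simp add: w_def norm_scaleC norm_mult)
    then have "\<Phi> 0 + w \<in> G"
      using covers[of w] KR by simp
    then have "cmod (cinner (\<Phi> 0 + w) (e 0)) < R"
      using assms by auto
    moreover have "cinner (\<Phi> 0 + w) (e 0) = of_real (cmod c + R) * s"
      using s(2) orthonormal_basisD(1)[OF assms(1), of 0 0]
      by (simp add: cinner_add_left cinner_scaleC_left w_def c_def[symmetric] algebra_simps)
    ultimately show False
      using s(1) assms(3) by (simp add: norm_mult del: of_real_add)
  qed
  then show ?thesis
    using \<epsilon>(1) by blast
qed

end
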